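(* For every integer $s\ge1$ we have $k(s,2)\ge k_2(s,2)\ge\left\lceil\frac{s}{2}\right\rceil+1$. Therefore, for $n=2$ and every $k\ge1$, the size of the minimal universal testing set over $\mathbb{Q}$ for tropical polynomials in $2$ variables with at most $k$ monomials is equal to $2k-1$.
   Context: A tropical polynomial over $\mathbb{Q}$ in $\vec{x}=(x_1,\dots,x_n)$ is a finite collection of tropical monomials $m_J(\vec{x}) = c_J + j_1x_1+\dots+j_nx_n$ with pairwise distinct exponent vectors $J=(j_1,\dots,j_n)$ and constants $c_J\in\mathbb{Q}$; its value is $p(\vec{x})=\max_J m_J(\vec{x})$. Here the exponents are allowed to be arbitrary rational numbers (this does not affect the quantities below compared with nonnegative integer exponents). A polynomial is nontrivial if it has at least one monomial. A point $\vec{a}\in\mathbb{Q}^n$ is a root of $p$ if the maximum $\max_J m_J(\vec{a})$ is attained on at least two distinct monomials; otherwise it is a non-root. $k(s,n)$ denotes the minimal number such that for any set $S$ of $s$ points in $\mathbb{Q}^n$ there is a nontrivial tropical polynomial over $\mathbb{Q}$ in $n$ variables with at most $k(s,n)$ monomials having roots in all the points of $S$. A universal testing set over $\mathbb{Q}$ for tropical polynomials of $n$ variables with at most $k$ monomials is a finite set $S\subseteq\mathbb{Q}^n$ such that every nontrivial tropical polynomial over $\mathbb{Q}$ in $n$ variables with at most $k$ monomials has a non-root in $S$. Bounded convex polyhedra in $n$-dimensional space are allowed to be degenerate (to have empty interior); boundary and interior are always taken in the ambient $n$-dimensional space. Two polyhedra $P$ and $Q$ are separated if there is a hyperplane $\pi$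 such that $P$ and $Q$ lie in different closed halfspaces with respect to $\pi$. Given a finite set $S$ of points in $n$-dimensional space ($S\subseteq\mathbb{Q}^n$), a double covering of $S$ of size $k$ is a family $P_1,\dots,P_k$ of bounded convex polyhedra that are pairwise separated and such that each point of $S$ lies on the boundary of at least two of the polyhedra $P_i$. $k_2(s,n)$ is the minimal number of polyhedra that is enough to double cover any $s$ points in $n$-dimensional space. *)

theory Defs
  imports "HOL-Analysis.Analysis"
begin

section \<open>Tropical polynomials over the rationals\<close>

text \<open>
  A monomial is a pair of an exponent vector \<open>J\<close> and a constant \<open>c\<close>. A polynomial is a finite set
  of monomials; injectivity of \<open>fst\<close> says that the exponent vectors are pairwise distinct.
\<close>

type_synonym 'n trop_monomial = "(rat ^ 'n) \<times> rat"

definition monomial_value :: "'n::finite trop_monomial \<Rightarrow> rat ^ 'n \<Rightarrow> rat" where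
  "monomial_value m x = snd m + (\<Sum>i\<in>UNIV. fst m $ i * x $ i)"

definition trop_poly :: "'n::finite trop_monomial set \<Rightarrow> bool" where
  "trop_poly p \<longleftrightarrow> finite p \<and> inj_on fst p"

definition nontrivial :: "'n::finite trop_monomial set \<Rightarrow> bool" where
  "nontrivial p \<longleftrightarrow> p \<noteq> {}"

definition trop_value :: "'n::finite trop_monomial set \<Rightarrow> rat ^ 'n \<Rightarrow> rat" where
  "trop_value p x = (MAX m\<in>p. monomial_value m x)"

definition trop_root :: "'n::finite trop_monomial set \<Rightarrow> rat ^ 'n \<Rightarrow> bool" where
  "trop_root p a \<longleftrightarrow>
     (\<exists>m\<in>p. \<exists>m'\<in>p. m \<noteq> m' \<and> monomial_value m a = trop_value p a
                         \<and> monomial_value m' a = trop_value p a)"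

text \<open>
  The dimension \<open>n\<close> is the cardinality of the index type \<open>'n\<close>, passed as a type argument
  where it cannot be inferred.
\<close>

definition min_monomials :: "nat \<Rightarrow> 'n::finite itself \<Rightarrow> nat" where
  "min_monomials s TYPE('n) =
     (LEAST k. \<forall>S::(rat ^ 'n) set. finite S \<and> card S = s \<longrightarrow>
        (\<exists>p. trop_poly p \<and> nontrivial p \<and> card p \<le> k \<and> (\<forall>a\<in>S. trop_root p a)))"

definition universal_testing_set :: "nat \<Rightarrow> (rat ^ 'n::finite) set \<Rightarrow> bool" where
  "universal_testing_set k S \<longleftrightarrow> finite S \<and>
     (\<forall>p. trop_poly p \<and> nontrivial p \<and> card p \<le> k \<longrightarrow> (\<exists>a\<in>S. \<not> trop_root p a))"

definition min_testing_size :: "nat \<Rightarrow> 'n::finite itself \<Rightarrow> nat" where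
  "min_testing_size k TYPE('n) =
     (LEAST m. \<exists>S::(rat ^ 'n) set. universal_testing_set k S \<and> card S = m)"

section \<open>Double coverings by polyhedra\<close>

definition separated :: "(real ^ 'n::finite) set \<Rightarrow> (real ^ 'n) set \<Rightarrow> bool" where
  "separated P Q \<longleftrightarrow>
     (\<exists>a b. a \<noteq> 0 \<and> P \<subseteq> {x. a \<bullet> x \<le> b} \<and> Q \<subseteq> {x. a \<bullet> x \<ge> b})"

text \<open>
  A covering is an indexed family, so a polyhedron may be repeated. Polyhedra are closed and
  convex, but may have empty interior; \<open>frontier\<close> is the boundary in the ambient space.
\<close>

definition double_covering ::
    "(real ^ 'n::finite) set \<Rightarrow> nat \<Rightarrow> (nat \<Rightarrow> (real ^ 'n) set) \<Rightarrow> bool" where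
  "double_covering S k P \<longleftrightarrow>
     (\<forall>i<k. polyhedron (P i) \<and> bounded (P i)) \<and>
     (\<forall>i<k. \<forall>j<k. i \<noteq> j \<longrightarrow> separated (P i) (P j)) \<and>
     (\<forall>x\<in>S. card {i. i < k \<and> x \<in> frontier (P i)} \<ge> 2)"

definition real_point :: "rat ^ 'n::finite \<Rightarrow> real ^ 'n" where
  "real_point x = (\<chi> i. of_rat (x $ i))"

text \<open>The points to be covered are rational, the polyhedra live in real space.\<close>

definition min_double_cover :: "nat \<Rightarrow> 'n::finite itself \<Rightarrow> nat" where
  "min_double_cover s TYPE('n) =
     (LEAST k. \<forall>S::(rat ^ 'n) set. finite S \<and> card S = s \<longrightarrow>
        (\<exists>P. double_covering (real_point ` S) k P))"

end

theory Submission
  imports Defs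
begin

text \<open>
  Three bounds on the plane carry the theorem.

  A polynomial yields a double covering with one polyhedron per monomial: cut the cells on which
  the single monomials are maximal down to a common box (\<open>double_covering_of_trop_poly\<close>). Two cells
  are separated by the hyperplane on which their monomials agree, and a root lies in two cells, hence
  on the boundary of both.

  A double covering of \<open>s\<close> points of the parabola \<open>y = x\<^sup>2\<close> needs \<open>k\<close> polyhedra with \<open>s \<le> 2k - 2\<close>
  (\<open>parabola_double_covering_bound\<close>). Order the points by their first coordinate and let \<open>A\<^sub>i\<close> be the
  points on the \<open>i\<close>-th polyhedron. A line cuts the parabola in the zeros of a polynomial of degree
  at most two; a sign count shows that if two of the sets \<open>A\<^sub>i\<close>, \<open>A\<^sub>j\<close> are separated by a line, then no
  point can be an inner (neither first nor last) element of both. Counting inner elements gives, for \<open>s \<ge> 2\<close>,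
  \<open>\<Sum>(|A\<^sub>i| - 2) \<le> s - 2\<close>, while each point lies in two of the sets, so \<open>\<Sum>|A\<^sub>i| \<ge> 2s\<close>. Geometrically, this
  bounds the number of triangles in a triangulation of a convex \<open>s\<close>-gon.

  Conversely any \<open>s\<close> points are roots of a polynomial with \<open>\<lceil>s/2\<rceil> + 1\<close> monomials
  (\<open>planar_roots_upper_bound\<close>): each new monomial handles two more points. Take two neighbouring
  points of \<open>S\<close> on a supporting line, find a polynomial for the rest by induction, and add a
  monomial that touches its graph above the two points and falls off steeply from the line towards
  the other points (\<open>extend_by_steep_monomial\<close>).

  The last two bounds meet: the parabola points form a universal testing set of size \<open>2k - 1\<close>, and no
  set with at most \<open>2k - 2\<close> points is one.
\<close>

section \<open>Adding a steep monomial\<close>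

lemma trop_value_ge:
  assumes "finite p" "m \<in> p"
  shows "monomial_value m x \<le> trop_value p x"
  unfolding trop_value_def using assms by (intro Max_ge) auto

lemma trop_value_attained:
  assumes "finite p" "p \<noteq> {}"
  obtains m where "m \<in> p" "monomial_value m x = trop_value p x"
proof -
  have "trop_value p x \<in> (\<lambda>m. monomial_value m x) ` p"
    unfolding trop_value_def using assms by (intro Max_in) auto
  then show thesis using that by force
qed

lemma trop_value_insert:
  assumes "finite p" "p \<noteq> {}"
  shows "trop_value (insert m p) x = max (monomial_value m x) (trop_value p x)"
  unfolding trop_value_def using assms by simp

lemma monomial_value_diff_scaled:
  "monomial_value (fst g - c *s fst h, snd g - c * snd h) x
     = monomial_value g x - c * monomial_value h x"
  by (simp add: monomial_value_def algebra_simps sum_subtractf sum_distrib_left)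

text \<open>
  The new monomial is \<open>g - c h\<close> with \<open>c\<close> large. On \<open>T\<close> it ties with the old maximum; at the old
  points off the hyperplane \<open>h = 0\<close> it drops below that maximum as \<open>c\<close> grows, so the old roots
  survive. Since the exponent of \<open>h\<close> is nonzero, only finitely many values of \<open>c\<close> reproduce an
  exponent that is already present.
\<close>

lemma extend_by_steep_monomial:
  fixes p :: "'n::finite trop_monomial set" and g h :: "'n trop_monomial"
  assumes p: "trop_poly p" "nontrivial p"
    and old: "\<forall>a\<in>S. trop_root p a" and fin: "finite S"
    and h: "fst h \<noteq> 0" "\<forall>a\<in>S. monomial_value h a \<ge> 0"
    and g: "\<forall>a\<in>S. monomial_value h a = 0 \<longrightarrow> monomial_value g a \<le> trop_value p a"
    and T: "\<forall>a\<in>T. monomial_value h a = 0 \<and> monomial_value g a = trop_value p a"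
  obtains l where "trop_poly (insert l p)" "\<forall>a\<in>S \<union> T. trop_root (insert l p) a"
proof -
  have finp: "finite p" and inj: "inj_on fst p" and ne: "p \<noteq> {}"
    using p by (auto simp: trop_poly_def nontrivial_def)
  define L where "L c = (fst g - c *s fst h, snd g - c * snd h)" for c
  have val: "monomial_value (L c) x = monomial_value g x - c * monomial_value h x" for c x
    unfolding L_def by (rule monomial_value_diff_scaled)
  have slope_inj: "inj (\<lambda>c. fst (L c))"
    using h(1) by (auto simp: inj_def L_def)
  define bad where "bad = (\<lambda>c. fst (L c)) -` (fst ` p)"
  have "finite bad"
    unfolding bad_def using finp slope_inj by (intro finite_vimageI) auto
  \<comment> \<open>Above every quotient the new monomial stays below the maximum at the corresponding point.\<close>
  define B where "B = (\<lambda>a. (monomial_value g a - trop_value p a) / monomial_value h a) ` S \<union> bad"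
  have "finite B" using fin \<open>finite bad\<close> by (simp add: B_def)
  then obtain c0 where c0: "\<forall>b\<in>B. b \<le> c0"
    by (metis Max_ge)
  define c where "c = c0 + 1"
  have cgt: "b < c" if "b \<in> B" for b using c0 that by (force simp: c_def)
  have notbad: "fst (L c) \<notin> fst ` p" using cgt by (auto simp: B_def bad_def)
  have new: "L c \<notin> p" using notbad by blast
  have le: "monomial_value (L c) a \<le> trop_value p a" if "a \<in> S" for a
  proof (cases "monomial_value h a = 0")
    case True
    then show ?thesis using g that by (simp add: val)
  next
    case False
    with h that have pos: "monomial_value h a > 0" by force
    have "(monomial_value g a - trop_value p a) / monomial_value h a < c"
      using that by (intro cgt) (auto simp: B_def)
    then show ?thesis using pos by (simp add: val field_simps)
  qed
  show thesis
  proof (rule that)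
    show "trop_poly (insert (L c) p)"
      using finp inj notbad new by (auto simp: trop_poly_def)
    show "\<forall>a\<in>S \<union> T. trop_root (insert (L c) p) a"
    proof
      fix a assume "a \<in> S \<union> T"
      then consider "a \<in> S" | "a \<in> T" by blast
      then show "trop_root (insert (L c) p) a"
      proof cases
        case 1
        then have "trop_value (insert (L c) p) a = trop_value p a"
          using le finp ne by (simp add: trop_value_insert max_def)
        moreover obtain m m' where "m \<in> p" "m' \<in> p" "m \<noteq> m'"
          "monomial_value m a = trop_value p a" "monomial_value m' a = trop_value p a"
          using old 1 unfolding trop_root_def by blast
        ultimately show ?thesis unfolding trop_root_def
          by (intro bexI[of _ m] bexI[of _ m']) auto
      next
        case 2
        then have eq: "monomial_value (L c) a = trop_value p a"
          using T by (simp add: val)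
        then have v: "trop_value (insert (L c) p) a = trop_value p a"
          using finp ne by (simp add: trop_value_insert)
        obtain m where "m \<in> p" "monomial_value m a = trop_value p a"
          using trop_value_attained[OF finp ne] .
        then show ?thesis using eq v new unfolding trop_root_def
          by (intro bexI[of _ "L c"] bexI[of _ m]) auto
      qed
    qed
  qed
qed

section \<open>Polynomials with few monomials through given points of the plane\<close>

lemma minimizer:
  fixes f :: "'a \<Rightarrow> 'b::linorder"
  assumes "finite A" "A \<noteq> {}"
  obtains a where "a \<in> A" "\<And>b. b \<in> A \<Longrightarrow> f a \<le> f b"
  using arg_min_if_finite[OF assms, of f] by (meson not_le)

lemma monomial_value_2:
  "monomial_value m (x :: rat ^ 2) = snd m + fst m $ 1 * x $ 1 + fst m $ 2 * x $ 2"
  by (simp add: monomial_value_def sum_2)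

lemma vec2_eq_iff: "(x :: 'a ^ 2) = y \<longleftrightarrow> x $ 1 = y $ 1 \<and> x $ 2 = y $ 2"
  by (simp add: vec_eq_iff forall_2)

text \<open>
  The line starts at a leftmost point \<open>u\<close>: it is vertical if another point lies above or below \<open>u\<close>,
  and otherwise goes through the point seen from \<open>u\<close> under the smallest slope. Affine functions are
  represented as monomials, ready for use in a polynomial.
\<close>

lemma supporting_line_through_two_points:
  fixes S :: "(rat ^ 2) set"
  assumes fin: "finite S" and two: "a \<in> S" "b \<in> S" "a \<noteq> b"
  obtains h where "fst h \<noteq> 0" "\<forall>x\<in>S. monomial_value h x \<ge> 0"
    "\<exists>u\<in>S. \<exists>v\<in>S. u \<noteq> v \<and> monomial_value h u = 0 \<and> monomial_value h v = 0"
proof -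
  obtain u where u: "u \<in> S" and umin: "\<And>x. x \<in> S \<Longrightarrow> u $ 1 \<le> x $ 1"
    using minimizer[OF fin, of "\<lambda>x. x $ 1"] two by blast
  show thesis
  proof (cases "\<exists>v\<in>S. v \<noteq> u \<and> v $ 1 = u $ 1")
    case True
    then obtain v where v: "v \<in> S" "v \<noteq> u" "v $ 1 = u $ 1" by blast
    show thesis
    proof (rule that[of "(vector [1, 0], - u $ 1)"])
      show "\<exists>u'\<in>S. \<exists>v'\<in>S. u' \<noteq> v' \<and> monomial_value (vector [1, 0], - u $ 1) u' = 0
          \<and> monomial_value (vector [1, 0], - u $ 1) v' = 0"
        using u v by (intro bexI[of _ u] bexI[of _ v]) (auto simp: monomial_value_2)
    qed (use umin in \<open>auto simp: monomial_value_2 vec2_eq_iff\<close>)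
  next
    case False
    then have right: "u $ 1 < x $ 1" if "x \<in> S - {u}" for x
      using umin that by (metis DiffE insertI1 order_le_less)
    have "finite (S - {u})" "S - {u} \<noteq> {}" using fin two by auto
    then obtain v where v: "v \<in> S - {u}" and
      vmin: "\<And>x. x \<in> S - {u} \<Longrightarrow>
        (v $ 2 - u $ 2) / (v $ 1 - u $ 1) \<le> (x $ 2 - u $ 2) / (x $ 1 - u $ 1)"
      using minimizer[of "S - {u}" "\<lambda>x. (x $ 2 - u $ 2) / (x $ 1 - u $ 1)"] by blast
    define \<sigma> where "\<sigma> = (v $ 2 - u $ 2) / (v $ 1 - u $ 1)"
    define h :: "2 trop_monomial" where "h = (vector [- \<sigma>, 1], \<sigma> * u $ 1 - u $ 2)"
    have h: "monomial_value h x = (x $ 2 - u $ 2) - \<sigma> * (x $ 1 - u $ 1)" for x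
      by (simp add: h_def monomial_value_2 algebra_simps)
    have "monomial_value h x \<ge> 0" if "x \<in> S" for x
    proof (cases "x = u")
      case False
      with that have "x \<in> S - {u}" by simp
      from vmin[OF this] right[OF this] show ?thesis
        by (simp add: h pos_le_divide_eq flip: \<sigma>_def)
    qed (simp add: h)
    moreover have "monomial_value h u = 0" "monomial_value h v = 0"
      using right[OF v] by (simp_all add: h \<sigma>_def)
    moreover have "fst h \<noteq> 0" by (simp add: h_def vec2_eq_iff)
    ultimately show thesis using that[of h] u v by auto
  qed
qed

text \<open>
  The supporting line may contain more than two points of \<open>S\<close>, and there steepness does not push the
  new monomial down. The two points \<open>u\<close>, \<open>v\<close> are therefore the first two on the line, so that every
  further point \<open>x\<close> lies beyond \<open>v\<close>; by convexity of the polynomial on the line, its value at \<open>x\<close> is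
  at least that of the affine function that agrees with it at \<open>u\<close> and \<open>v\<close>.
\<close>

lemma planar_roots_upper_bound:
  fixes S :: "(rat ^ 2) set"
  assumes "finite S"
  shows "\<exists>p. trop_poly p \<and> nontrivial p \<and> card p \<le> (card S + 1) div 2 + 1
             \<and> (\<forall>a\<in>S. trop_root p a)"
  using assms
proof (induction "card S" arbitrary: S rule: less_induct)
  case less
  consider "S = {}" | a where "S = {a}" | a b where "a \<in> S" "b \<in> S" "a \<noteq> b"
    by (metis is_singletonI' is_singleton_the_elem)
  then show ?case
  proof cases
    case 1
    then show ?thesis
      by (intro exI[of _ "{(0, 0)}"]) (auto simp: trop_poly_def nontrivial_def)
  next
    case (2 a)
    define q :: "2 trop_monomial set" where "q = {(0, 0), (vector [1, 0], - a $ 1)}"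
    have "trop_poly q" "nontrivial q" "card q \<le> 2"
      by (auto simp: q_def trop_poly_def nontrivial_def vec2_eq_iff card_insert_if)
    moreover have "\<forall>x\<in>S. trop_root q x"
      using 2 by (auto simp: q_def trop_root_def trop_value_def monomial_value_2 vec2_eq_iff)
    ultimately show ?thesis using 2 by (intro exI[of _ q]) auto
  next
    case (3 a b)
    then obtain h where h: "fst h \<noteq> 0" "\<forall>x\<in>S. monomial_value h x \<ge> 0"
      and two: "\<exists>u\<in>S. \<exists>v\<in>S. u \<noteq> v \<and> monomial_value h u = 0 \<and> monomial_value h v = 0"
      using supporting_line_through_two_points[OF less.prems] by metis
    \<comment> \<open>a coordinate along the line \<open>h = 0\<close>\<close>
    define \<psi> where "\<psi> x = fst h $ 1 * x $ 2 - fst h $ 2 * x $ 1" for x :: "rat ^ 2"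
    define Z where "Z = {x \<in> S. monomial_value h x = 0}"
    have finZ: "finite Z" using less.prems by (simp add: Z_def)
    have \<psi>_inj: "x = y" if xy: "monomial_value h x = 0" "monomial_value h y = 0" "\<psi> x = \<psi> y" for x y
    proof -
      define A B where "A = fst h $ 1" and "B = fst h $ 2"
      define d e where "d = x $ 1 - y $ 1" and "e = x $ 2 - y $ 2"
      have "A * d + B * e = 0" "A * e - B * d = 0"
        using xy by (simp_all add: monomial_value_2 \<psi>_def A_def B_def d_def e_def algebra_simps)
      then have "(A * d + B * e)\<^sup>2 + (A * e - B * d)\<^sup>2 = 0" by simp
      \<comment> \<open>Lagrange's two-square identity\<close>
      then have "(A\<^sup>2 + B\<^sup>2) * (d\<^sup>2 + e\<^sup>2) = 0"
        by (simp add: power2_eq_square algebra_simps)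
      moreover have "A\<^sup>2 + B\<^sup>2 \<noteq> 0"
        using h(1) by (auto simp: A_def B_def vec2_eq_iff sum_power2_eq_zero_iff)
      ultimately have "d\<^sup>2 + e\<^sup>2 = 0" using mult_eq_0_iff by blast
      then show "x = y" by (simp add: d_def e_def vec2_eq_iff sum_power2_eq_zero_iff)
    qed
    obtain u where u: "u \<in> Z" and umin: "\<And>x. x \<in> Z \<Longrightarrow> \<psi> u \<le> \<psi> x"
      using minimizer[OF finZ, of \<psi>] two by (auto simp: Z_def)
    have "Z - {u} \<noteq> {}" using two by (auto simp: Z_def)
    then obtain v where v: "v \<in> Z - {u}" and vmin: "\<And>x. x \<in> Z - {u} \<Longrightarrow> \<psi> v \<le> \<psi> x"
      using minimizer[of "Z - {u}" \<psi>] finZ by auto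
    have uv: "\<psi> u < \<psi> v" using u v umin[of v] \<psi>_inj[of u v] by (force simp: Z_def order_le_less)
    define S' where "S' = S - {u, v}"
    have sub: "u \<in> S" "v \<in> S" "u \<noteq> v" using u v by (auto simp: Z_def)
    have S: "S = S' \<union> {u, v}" using sub by (auto simp: S'_def)
    have finS': "finite S'" using less.prems by (simp add: S'_def)
    have cS: "card S = card S' + 2"
      unfolding S using finS' sub(3) by (subst card_Un_disjoint) (auto simp: S'_def)
    obtain p where p: "trop_poly p" "nontrivial p" "card p \<le> (card S' + 1) div 2 + 1"
      and roots: "\<forall>a\<in>S'. trop_root p a"
      using less.hyps[of S'] cS finS' by auto
    have finp: "finite p" "p \<noteq> {}" using p by (auto simp: trop_poly_def nontrivial_def)
    \<comment> \<open>\<open>g\<close> interpolates the polynomial linearly in \<open>\<psi>\<close> at \<open>u\<close> and \<open>v\<close>.\<close>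
    define \<kappa> where "\<kappa> = (trop_value p v - trop_value p u) / (\<psi> v - \<psi> u)"
    define g :: "2 trop_monomial" where
      "g = (vector [- \<kappa> * fst h $ 2, \<kappa> * fst h $ 1], trop_value p u - \<kappa> * \<psi> u)"
    have g: "monomial_value g x = trop_value p u + \<kappa> * (\<psi> x - \<psi> u)" for x
      by (simp add: g_def monomial_value_2 \<psi>_def algebra_simps)
    have gu: "monomial_value g u = trop_value p u" by (simp add: g)
    have gv: "monomial_value g v = trop_value p v" using uv by (simp add: g \<kappa>_def)
    have gle: "monomial_value g x \<le> trop_value p x" if x: "x \<in> S'" "monomial_value h x = 0" for x
    proof -
      have xZ: "x \<in> Z - {u}" using x by (auto simp: Z_def S'_def)
      have vx: "\<psi> v \<le> \<psi> x" by (rule vmin[OF xZ])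
      \<comment> \<open>A monomial that is maximal at \<open>v\<close> and at most the maximum at \<open>u\<close> overtakes \<open>g\<close> beyond \<open>v\<close>.\<close>
      obtain m where m: "m \<in> p" "monomial_value m v = trop_value p v"
        using trop_value_attained[OF finp] .
      have mu: "monomial_value m u \<le> trop_value p u" using trop_value_ge finp m by blast
      define \<mu> where "\<mu> = (\<psi> x - \<psi> u) / (\<psi> v - \<psi> u)"
      have \<mu>: "\<mu> \<ge> 1" using vx uv by (simp add: \<mu>_def)
      define w where "w = u + \<mu> *s (v - u)"
      have lin: "monomial_value n w = monomial_value n u
            + \<mu> * (monomial_value n v - monomial_value n u)" for n
        by (simp add: w_def monomial_value_2 algebra_simps)
      have "\<psi> w = \<psi> u + \<mu> * (\<psi> v - \<psi> u)" by (simp add: w_def \<psi>_def algebra_simps)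
      then have "\<psi> w = \<psi> x" using uv by (simp add: \<mu>_def)
      moreover have hw: "monomial_value h w = 0" using lin[of h] u v by (simp add: Z_def)
      ultimately have xw: "x = w" using x(2) by (intro \<psi>_inj) simp_all
      have "monomial_value g x = trop_value p u + \<mu> * (trop_value p v - trop_value p u)"
        using lin[of g] by (simp add: xw gu gv)
      also have "\<dots> = \<mu> * trop_value p v - (\<mu> - 1) * trop_value p u" by (simp add: algebra_simps)
      also have "\<dots> \<le> \<mu> * trop_value p v - (\<mu> - 1) * monomial_value m u"
        using \<mu> mu by (simp add: mult_left_mono)
      also have "\<dots> = monomial_value m x"
        using lin[of m] m by (simp add: xw algebra_simps)
      also have "\<dots> \<le> trop_value p x" using trop_value_ge finp m by blast
      finally show ?thesis .
    qed
    obtain l where l: "trop_poly (insert l p)" "\<forall>a\<in>S' \<union> {u, v}. trop_root (insert l p) a"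
    proof (rule extend_by_steep_monomial[OF p(1,2) roots finS' h(1)])
      show "\<forall>a\<in>S'. 0 \<le> monomial_value h a" using h(2) S by blast
      show "\<forall>a\<in>S'. monomial_value h a = 0 \<longrightarrow> monomial_value g a \<le> trop_value p a"
        using gle by blast
      show "\<forall>a\<in>{u, v}. monomial_value h a = 0 \<and> monomial_value g a = trop_value p a"
        using u v gu gv by (auto simp: Z_def)
    qed
    have "card (insert l p) \<le> card p + 1" using finp by (simp add: card_insert_if)
    also have "\<dots> \<le> (card S + 1) div 2 + 1" using p(3) cS by simp
    finally show ?thesis using l S by (intro exI[of _ "insert l p"]) (auto simp: nontrivial_def)
  qed
qed

section \<open>From polynomials to double coverings\<close>

definition real_value :: "'n::finite trop_monomial \<Rightarrow> real ^ 'n \<Rightarrow> real" where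
  "real_value m x = of_rat (snd m) + real_point (fst m) \<bullet> x"

lemma real_value_real_point: "real_value m (real_point x) = of_rat (monomial_value m x)"
  by (simp add: real_value_def monomial_value_def real_point_def inner_vec_def
      of_rat_add of_rat_sum of_rat_mult)

lemma real_point_eq_iff [simp]: "real_point x = real_point y \<longleftrightarrow> x = y"
  by (simp add: real_point_def vec_eq_iff)

definition cell :: "'n::finite trop_monomial set \<Rightarrow> 'n trop_monomial \<Rightarrow> (real ^ 'n) set" where
  "cell p m = {x. \<forall>m'\<in>p. real_value m' x \<le> real_value m x}"

lemma real_value_le_iff:
  "real_value m' x \<le> real_value m x \<longleftrightarrow>
     (real_point (fst m') - real_point (fst m)) \<bullet> x \<le> of_rat (snd m) - of_rat (snd m')"
  by (auto simp: real_value_def inner_diff_left)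

lemma polyhedron_cell:
  assumes "finite p"
  shows "polyhedron (cell p m)"
proof -
  have "cell p m = \<Inter> ((\<lambda>m'. {x. real_value m' x \<le> real_value m x}) ` p)"
    by (auto simp: cell_def)
  also have "polyhedron \<dots>"
    using assms by (intro polyhedron_Inter) (auto simp: real_value_le_iff polyhedron_halfspace_le)
  finally show ?thesis .
qed

lemma separated_mono:
  assumes "separated P Q" "P' \<subseteq> P" "Q' \<subseteq> Q"
  shows "separated P' Q'"
  using assms unfolding separated_def by (meson subset_trans)

lemma separated_cells:
  assumes "m \<in> p" "m' \<in> p" "fst m \<noteq> fst m'"
  shows "separated (cell p m) (cell p m')"
  unfolding separated_def
proof (intro exI conjI)
  show "real_point (fst m') - real_point (fst m) \<noteq> 0" using assms by simp
  show "cell p m \<subseteq> {x. (real_point (fst m') - real_point (fst m)) \<bullet> x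
      \<le> of_rat (snd m) - of_rat (snd m')}"
    using assms by (auto simp: cell_def real_value_le_iff)
  have "real_value m x \<le> real_value m' x" if "x \<in> cell p m'" for x
    using assms that by (auto simp: cell_def)
  then show "cell p m' \<subseteq> {x. (real_point (fst m') - real_point (fst m)) \<bullet> x
      \<ge> of_rat (snd m) - of_rat (snd m')}"
    by (force simp: real_value_def inner_diff_left)
qed

text \<open>
  A common point of two separated sets lies on the separating hyperplane, and no interior point of a
  set lies on the boundary of a halfspace containing the set.
\<close>

lemma in_frontier_of_separated:
  fixes P Q :: "(real ^ 'n::finite) set"
  assumes "separated P Q \<or> separated Q P" "x \<in> P" "x \<in> Q"
  shows "x \<in> frontier P"
proof -
  obtain a b where ab: "a \<noteq> 0" "P \<subseteq> {y. a \<bullet> y \<le> b}" "a \<bullet> x \<ge> b"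
  proof (cases "separated P Q")
    case True
    then show thesis using that assms(3) unfolding separated_def by blast
  next
    case False
    then obtain a b where "a \<noteq> 0" "Q \<subseteq> {x. a \<bullet> x \<le> b}" "P \<subseteq> {x. a \<bullet> x \<ge> b}"
      using assms(1) unfolding separated_def by blast
    then show thesis using that[of "- a" "- b"] assms(3) by auto
  qed
  have "interior P \<subseteq> {y. a \<bullet> y < b}"
    using interior_mono[OF ab(2)] ab(1) by (simp add: interior_halfspace_le)
  then have "x \<notin> interior P" using ab(3) by auto
  then show ?thesis using assms(2) closure_subset by (auto simp: frontier_def)
qed

lemma separated_empty:
  fixes Q :: "(real ^ 'n::finite) set"
  assumes "bounded Q"
  shows "separated Q {}" "separated {} Q"
proof -
  obtain a :: "real ^ 'n" where a: "a \<noteq> 0" using zero_neq_one by metis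
  have "bounded ((\<lambda>x. a \<bullet> x) ` Q)"
    using assms by (intro bounded_linear_image bounded_linear_inner_right)
  then obtain B where B: "\<forall>x\<in>Q. \<bar>a \<bullet> x\<bar> \<le> B" by (auto simp: bounded_real)
  then have "Q \<subseteq> {x. a \<bullet> x \<le> B}" "Q \<subseteq> {x. a \<bullet> x \<ge> - B}" by (auto simp: abs_le_iff)
  then show "separated Q {}" "separated {} Q"
    using a unfolding separated_def by blast+
qed

text \<open>
  The cells of the monomials are cut down to a box around \<open>S\<close>, which makes them bounded, and the
  family is padded with empty polyhedra up to length \<open>k\<close>.
\<close>

lemma double_covering_of_trop_poly:
  fixes p :: "'n::finite trop_monomial set"
  assumes p: "trop_poly p" "card p \<le> k" and fin: "finite S"
    and roots: "\<forall>a\<in>S. trop_root p a"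
  shows "\<exists>P. double_covering (real_point ` S) k P"
proof -
  have finp: "finite p" and inj: "inj_on fst p" using p by (auto simp: trop_poly_def)
  obtain f where f: "bij_betw f {0..<card p} p" using ex_bij_betw_nat_finite[OF finp] ..
  have "bounded (real_point ` S)" using fin by (simp add: finite_imp_bounded)
  then obtain r where r: "real_point ` S \<subseteq> cbox (- r) r"
    using bounded_subset_cbox_symmetric by blast
  define P where "P i = (if i < card p then cell p (f i) \<inter> cbox (- r) r else {})" for i
  have fi: "f i \<in> p" if "i < card p" for i using f that by (auto simp: bij_betw_def)
  have sep: "separated (P i) (P j)" if "i \<noteq> j" for i j
  proof (cases "i < card p \<and> j < card p")
    case True
    then have "f i \<noteq> f j" using f that by (auto simp: bij_betw_def inj_on_def)
    then have "fst (f i) \<noteq> fst (f j)" using inj fi True by (auto simp: inj_on_def)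
    then have "separated (cell p (f i)) (cell p (f j))" using True fi by (intro separated_cells) auto
    then show ?thesis by (rule separated_mono) (auto simp: P_def)
  next
    case False
    have "bounded (P i)" "bounded (P j)"
      by (auto simp: P_def intro: bounded_subset[OF bounded_cbox])
    then show ?thesis using False separated_empty by (auto simp: P_def)
  qed
  show ?thesis
  proof (intro exI[of _ P], unfold double_covering_def, intro conjI allI impI ballI)
    show "polyhedron (P i)" for i
      using polyhedron_Int[OF polyhedron_cell[OF finp] polytope_imp_polyhedron[OF polytope_interval]]
      by (simp add: P_def)
    show "bounded (P i)" for i
      by (auto simp: P_def intro: bounded_subset[OF bounded_cbox])
    show "separated (P i) (P j)" if "i \<noteq> j" for i j using sep that .
  next
    fix x assume "x \<in> real_point ` S"
    then obtain a where a: "a \<in> S" "x = real_point a" by blast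
    obtain m m' where m: "m \<in> p" "m' \<in> p" "m \<noteq> m'"
      "monomial_value m a = trop_value p a" "monomial_value m' a = trop_value p a"
      using roots a unfolding trop_root_def by blast
    have in_cell: "x \<in> cell p n" if "monomial_value n a = trop_value p a" for n
      using that trop_value_ge[OF finp] by (auto simp: cell_def a(2) real_value_real_point of_rat_less_eq)
    have "m \<in> f ` {0..<card p}" "m' \<in> f ` {0..<card p}"
      using f m(1,2) by (simp_all add: bij_betw_def)
    then obtain i j where ij: "i < card p" "j < card p" "f i = m" "f j = m'" by auto
    have "i \<noteq> j" using ij m(3) by blast
    have "x \<in> P i" "x \<in> P j" using in_cell m ij r a by (auto simp: P_def)
    with sep[of i j] sep[of j i] \<open>i \<noteq> j\<close> have "x \<in> frontier (P i)" "x \<in> frontier (P j)"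
      by (auto intro: in_frontier_of_separated)
    then have "{i, j} \<subseteq> {i. i < k \<and> x \<in> frontier (P i)}" using ij p(2) by auto
    then have "card {i, j} \<le> card {i. i < k \<and> x \<in> frontier (P i)}" by (intro card_mono) auto
    then show "2 \<le> card {i. i < k \<and> x \<in> frontier (P i)}" using \<open>i \<noteq> j\<close> by simp
  qed
qed

section \<open>Double coverings of points on a parabola\<close>

definition parabola :: "nat \<Rightarrow> rat ^ 2" where
  "parabola t = vector [of_nat t, (of_nat t)\<^sup>2]"

lemma inj_parabola: "inj parabola"
  by (auto simp: inj_def parabola_def vec2_eq_iff)

definition middle :: "'a::linorder set \<Rightarrow> 'a set" where
  "middle A = {t \<in> A. (\<exists>a\<in>A. a < t) \<and> (\<exists>b\<in>A. t < b)}"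

lemma card_le_card_middle:
  assumes "finite A"
  shows "card A \<le> card (middle A) + 2"
proof (cases "A = {}")
  case False
  have "A \<subseteq> middle A \<union> {Min A, Max A}"
  proof
    fix t assume t: "t \<in> A"
    have "Min A \<in> A" "Max A \<in> A" "Min A \<le> t" "t \<le> Max A" using assms t False by auto
    then show "t \<in> middle A \<union> {Min A, Max A}"
      using t by (auto simp: middle_def order_le_less)
  qed
  then have "card A \<le> card (middle A \<union> {Min A, Max A})"
    using assms by (intro card_mono) (auto simp: middle_def)
  also have "\<dots> \<le> card (middle A) + card {Min A, Max A}" by (rule card_Un_le)
  also have "\<dots> \<le> card (middle A) + 2" by (simp add: card_insert_if)
  finally show ?thesis .
qed simp

text \<open>
  Such a \<open>q\<close> vanishes at \<open>t\<close>, so it is \<open>x - t\<close> times an affine function \<open>h\<close>. The signs at \<open>a\<close>, \<open>a'\<close>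
  force \<open>h\<close> not to increase and those at \<open>b\<close>, \<open>b'\<close> force it not to decrease; hence \<open>h\<close> is constant, and
  its sign is both nonnegative and nonpositive.
\<close>

lemma quadratic_sign_interlacing:
  fixes \<alpha> \<beta> \<gamma> :: real
  defines "q \<equiv> \<lambda>x. \<alpha> * x\<^sup>2 + \<beta> * x + \<gamma>"
  assumes order: "a < t" "t < a'" "b < t" "t < b'"
    and nonpos: "q a \<le> 0" "q t \<le> 0" "q a' \<le> 0"
    and nonneg: "q b \<ge> 0" "q t \<ge> 0" "q b' \<ge> 0"
  shows "\<alpha> = 0 \<and> \<beta> = 0"
proof -
  define h where "h x = \<alpha> * (x + t) + \<beta>" for x
  have fact: "q x = (x - t) * h x" for x
  proof -
    have "q x - q t = (x - t) * h x"
      by (simp add: q_def h_def algebra_simps power2_eq_square)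
    then show ?thesis using nonpos nonneg by simp
  qed
  have ha: "h a \<ge> 0" "h a' \<le> 0" "h b \<le> 0" "h b' \<ge> 0"
    using order nonpos(1,3) nonneg(1,3)
    by (simp_all add: fact mult_le_0_iff zero_le_mult_iff)
  have "h a' - h a = \<alpha> * (a' - a)" "h b' - h b = \<alpha> * (b' - b)"
    by (simp_all add: h_def algebra_simps)
  then have "\<alpha> * (a' - a) \<le> 0" "\<alpha> * (b' - b) \<ge> 0" using ha by linarith+
  then have "\<alpha> = 0" using order by (auto simp: mult_le_0_iff zero_le_mult_iff)
  moreover from this have "\<beta> = 0" using ha by (simp add: h_def)
  ultimately show ?thesis by simp
qed

text \<open>
  Along the parabola the separating line restricts to a nonconstant quadratic or affine polynomial in
  the parameter, nonpositive on \<open>A\<close> and nonnegative on \<open>B\<close>.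
\<close>

lemma separated_middles_disjoint:
  assumes sep: "separated P Q"
    and A: "real_point ` parabola ` A \<subseteq> P" and B: "real_point ` parabola ` B \<subseteq> Q"
  shows "middle A \<inter> middle B = {}"
proof (rule ccontr)
  assume "middle A \<inter> middle B \<noteq> {}"
  then obtain t a a' b b' where tab: "t \<in> A" "t \<in> B" "a \<in> A" "a' \<in> A" "b \<in> B" "b' \<in> B"
    "a < t" "t < a'" "b < t" "t < b'"
    unfolding middle_def by blast
  obtain v c where vc: "v \<noteq> 0" "P \<subseteq> {x. v \<bullet> x \<le> c}" "Q \<subseteq> {x. v \<bullet> x \<ge> c}"
    using sep unfolding separated_def by blast
  have val: "v \<bullet> real_point (parabola n) = v $ 2 * (real n)\<^sup>2 + v $ 1 * real n" for n
    by (simp add: inner_vec_def sum_2 real_point_def parabola_def of_rat_power)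
  have neg: "v $ 2 * (real n)\<^sup>2 + v $ 1 * real n + - c \<le> 0" if "n \<in> A" for n
    using vc(2) A that val[of n] by force
  have pos: "v $ 2 * (real n)\<^sup>2 + v $ 1 * real n + - c \<ge> 0" if "n \<in> B" for n
    using vc(3) B that val[of n] by force
  have "v $ 2 = 0 \<and> v $ 1 = 0"
    by (rule quadratic_sign_interlacing[of "real a" "real t" "real a'" "real b" "real b'" _ _ "- c"])
      (use tab neg pos in auto)
  then show False using vc(1) by (simp add: vec2_eq_iff)
qed

text \<open>
  The bound comes from counting incidences of points and polyhedra in both ways: at least two per
  point, and at most two per polyhedron besides the pairwise disjoint sets of inner points, which
  also avoid the first and the last point overall.
\<close>

lemma parabola_double_covering_bound:
  assumes P: "double_covering (real_point ` parabola ` {..<s}) k P" and s: "s \<ge> 1"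
  shows "s + 2 \<le> 2 * k"
proof -
  define A where "A i = {t. t < s \<and> real_point (parabola t) \<in> P i}" for i
  have finA: "finite (A i)" for i by (simp add: A_def)
  have closed: "closed (P i)" if "i < k" for i
    using P that by (auto simp: double_covering_def polyhedron_imp_closed)
  have twice: "2 \<le> card {i. i < k \<and> t \<in> A i}" if t: "t < s" for t
  proof -
    let ?x = "real_point (parabola t)"
    have "2 \<le> card {i. i < k \<and> ?x \<in> frontier (P i)}"
      using P t by (auto simp: double_covering_def)
    also have "\<dots> \<le> card {i. i < k \<and> t \<in> A i}"
      using closed t by (intro card_mono) (auto simp: A_def frontier_def)
    finally show ?thesis .
  qed
  have disj: "middle (A i) \<inter> middle (A j) = {}" if "i < k" "j < k" "i \<noteq> j" for i j
    using P that by (intro separated_middles_disjoint[of "P i" "P j"])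
      (auto simp: double_covering_def A_def)
  have mid_sub: "(\<Union>i<k. middle (A i)) \<subseteq> {1..<s - 1}"
    by (auto simp: middle_def A_def)
  have "(\<Sum>i<k. card (middle (A i))) = card (\<Union>i<k. middle (A i))"
    using disj finA by (intro card_UN_disjoint[symmetric]) (auto simp: middle_def)
  also have "\<dots> \<le> s - 2" using card_mono[OF _ mid_sub] by simp
  finally have mids: "(\<Sum>i<k. card (middle (A i))) \<le> s - 2" .
  have "2 * s = (\<Sum>t<s. 2)" by simp
  also have "\<dots> \<le> (\<Sum>t<s. card {i. i < k \<and> t \<in> A i})" using twice by (intro sum_mono) auto
  also have "\<dots> = (\<Sum>i<k. card (A i))"
  proof -
    have "card {i. i < k \<and> t \<in> A i} = (\<Sum>i<k. of_bool (t \<in> A i))" for t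
      by (simp add: Int_def lessThan_def)
    moreover have "card (A i) = (\<Sum>t<s. of_bool (t \<in> A i))" for i
      by (simp add: Int_def A_def)
    ultimately show ?thesis by (simp only: sum.swap[of _ "{..<k}"])
  qed
  also have "\<dots> \<le> (\<Sum>i<k. card (middle (A i)) + 2)"
    using finA by (intro sum_mono card_le_card_middle)
  also have "\<dots> \<le> (s - 2) + 2 * k" using mids by (subst sum.distrib) simp
  finally have main: "2 * s \<le> (s - 2) + 2 * k" .
  \<comment> \<open>For \<open>s = 1\<close> the difference \<open>s - 2\<close> is truncated to 0, and the count alone yields only \<open>k \<ge> 1\<close>.\<close>
  moreover have "2 \<le> k"
  proof -
    have "2 \<le> card {i. i < k \<and> 0 \<in> A i}" using twice s by simp
    also have "\<dots> \<le> card {..<k}" by (intro card_mono) auto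
    finally show ?thesis by simp
  qed
  ultimately show ?thesis using s by linarith
qed

section \<open>The minimal sizes in the plane\<close>

lemma card_parabola: "card (parabola ` {..<s}) = s"
  using inj_parabola by (simp add: card_image inj_on_subset)

theorem theorem20:
  shows "(\<forall>s::nat. s \<ge> 1 \<longrightarrow>
            min_monomials s TYPE(2) \<ge> min_double_cover s TYPE(2) \<and>
            int (min_double_cover s TYPE(2)) \<ge> \<lceil>real s / 2\<rceil> + 1)
       \<and> (\<forall>k::nat. k \<ge> 1 \<longrightarrow> min_testing_size k TYPE(2) = 2 * k - 1)"
proof (intro conjI allI impI)
  fix s :: nat assume s: "s \<ge> 1"
  define polyOK where "polyOK k \<longleftrightarrow> (\<forall>S::(rat ^ 2) set. finite S \<and> card S = s \<longrightarrow>
        (\<exists>p. trop_poly p \<and> nontrivial p \<and> card p \<le> k \<and> (\<forall>a\<in>S. trop_root p a)))" for k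
  define covOK where "covOK k \<longleftrightarrow> (\<forall>S::(rat ^ 2) set. finite S \<and> card S = s \<longrightarrow>
        (\<exists>P. double_covering (real_point ` S) k P))" for k
  have mm: "min_monomials s TYPE(2) = (LEAST k. polyOK k)"
    by (simp add: min_monomials_def polyOK_def)
  have mc: "min_double_cover s TYPE(2) = (LEAST k. covOK k)"
    by (simp add: min_double_cover_def covOK_def)
  have "polyOK ((s + 1) div 2 + 1)"
    unfolding polyOK_def using planar_roots_upper_bound by blast
  then have "polyOK (LEAST k. polyOK k)" by (rule LeastI)
  then have cov: "covOK (LEAST k. polyOK k)"
    unfolding polyOK_def covOK_def using double_covering_of_trop_poly by blast
  then show "min_monomials s TYPE(2) \<ge> min_double_cover s TYPE(2)"
    unfolding mm mc by (rule Least_le)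
  have "covOK (LEAST k. covOK k)" using cov by (rule LeastI)
  then obtain P where "double_covering (real_point ` parabola ` {..<s}) (LEAST k. covOK k) P"
    unfolding covOK_def using card_parabola[of s] by blast
  then have "s + 2 \<le> 2 * (LEAST k. covOK k)" using s by (rule parabola_double_covering_bound)
  then show "int (min_double_cover s TYPE(2)) \<ge> \<lceil>real s / 2\<rceil> + 1"
    unfolding mc by linarith
next
  fix k :: nat assume k: "k \<ge> 1"
  show "min_testing_size k TYPE(2) = 2 * k - 1"
    unfolding min_testing_size_def
  proof (rule Least_equality)
    define S where "S = parabola ` {..<2 * k - 1}"
    have "\<exists>a\<in>S. \<not> trop_root p a" if p: "trop_poly p" "card p \<le> k" for p
    proof (rule ccontr)
      assume "\<not> (\<exists>a\<in>S. \<not> trop_root p a)"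
      then obtain P where "double_covering (real_point ` S) k P"
        using double_covering_of_trop_poly[OF p, of S] by (auto simp: S_def)
      then have "(2 * k - 1) + 2 \<le> 2 * k"
        unfolding S_def using k by (intro parabola_double_covering_bound) auto
      then show False using k by simp
    qed
    then have "universal_testing_set k S"
      by (auto simp: universal_testing_set_def S_def)
    then show "\<exists>S::(rat ^ 2) set. universal_testing_set k S \<and> card S = 2 * k - 1"
      unfolding S_def using card_parabola by blast
  next
    fix m assume "\<exists>S::(rat ^ 2) set. universal_testing_set k S \<and> card S = m"
    then obtain S :: "(rat ^ 2) set" where S: "universal_testing_set k S" "card S = m" by blast
    have fin: "finite S" using S by (simp add: universal_testing_set_def)
    obtain p where p: "trop_poly p" "nontrivial p" "card p \<le> (card S + 1) div 2 + 1"
      "\<forall>a\<in>S. trop_root p a"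
      using planar_roots_upper_bound[OF fin] by blast
    then have "\<not> card p \<le> k" using S by (auto simp: universal_testing_set_def)
    then show "2 * k - 1 \<le> m" using p(3) S(2) by linarith
  qed
qed

end
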